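(* Let $R$ be a countable ring and let $R_d$ denote $R$ with the discrete topology. Let $\chi$ be a character on the discrete additive group $(R_d,+)$, i.e. a group homomorphism from $(R,+)$ to $\mathbb{T}=\{z\in\mathbb{C}:|z|=1\}$, and let $q(t)$ be a polynomial with coefficients in $R$. Then the function $t\mapsto\chi(q(t))$ on $R$ belongs to $W(R_d,+)$ and is a distal function, i.e. belongs to $D(R_d,+)$.
   Context: A polynomial with coefficients in $R$ is viewed as the function $q(t)=a_0+a_1t+\dots+a_dt^d$ on $R$, with $a_0,\dots,a_d\in R$. $\mathbb{N}=\{1,2,\dots\}$. For a semitopological semigroup $S$ (all left and right translations continuous), $C(S)$ is the $C^*$-algebra of bounded continuous complex-valued functions with the sup norm, and $(L_sf)(t)=f(st)$ (with the semigroup operation of $S$; for $S=(R_d,+)$ it is addition). $LMC(S)$ is the set of $f\in C(S)$ such that $s\mapsto\mu(L_sf)$ is continuous on $S$ for every $\mu$ in the spectrum of $C(S)$; it is a unital $C^*$-subalgebra, and for $\mu$ in its spectrum $S^{LMC}$ (the nonzero multiplicative linear functionals on $LMC(S)$) the formula $(T_\mu f)(s)=\mu(L_sf)$ defines a map $T_\mu:LMC(S)\to LMC(S)$. Put $\Sigma=\{T_\mu:\mu\in S^{LMC}\}$, a semigroup under composition. For discrete $S$, $LMC(S)=\ell^\infty(S)$. $D(S)$, the set of distal functions on $S$, consists of all $f\in LMC(S)$ with $\varepsilon(\sigma(f))=\sigma(f)$ for every $\sigma\in\Sigma$ and every idempotent $\varepsilon\in\Sigma$. Let $F_0$ be the set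 of constant functions on $S$ of modulus $1$, and inductively for $k\ge 1$ let $$F_k=\{f\in LMC(S): |f|=1 \text{ and for every }\sigma\in\Sigma \text{ there is } f_\sigma\in F_{k-1}\text{ with }\sigma(f)=f_\sigma f\},$$ where $|f|=1$ means $|f(s)|=1$ for all $s\in S$. Let $W(S)$ be the norm closure in $C(S)$ of the (complex) algebra generated by $\bigcup_{k\in\mathbb{N}}F_k$. *)

theory Defs
  imports "HOL-Analysis.Analysis"
begin

text \<open>
  A semigroup with a topology is given by its operation \<open>m\<close> on a type \<open>'s\<close> and a topology \<open>X\<close>
  on the whole of \<open>'s\<close>. The topology is an explicit argument, so that the additive group of
  a ring can be taken with the discrete topology.
\<close>

definition semitopological_semigroup :: "'s topology \<Rightarrow> ('s \<Rightarrow> 's \<Rightarrow> 's) \<Rightarrow> bool" where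
  "semitopological_semigroup X m \<longleftrightarrow>
     topspace X = UNIV \<and>
     (\<forall>r s t. m (m r s) t = m r (m s t)) \<and>
     (\<forall>s. continuous_map X X (\<lambda>t. m s t)) \<and>
     (\<forall>s. continuous_map X X (\<lambda>t. m t s))"

lemma semitopological_semigroup_discrete:
  "semitopological_semigroup (discrete_topology UNIV) ((+) :: 'a :: semigroup_add \<Rightarrow> 'a \<Rightarrow> 'a)"
  by (simp add: semitopological_semigroup_def add.assoc)

definition bounded_cont :: "'s topology \<Rightarrow> ('s \<Rightarrow> complex) set" where
  "bounded_cont X = {f. continuous_map X euclidean f \<and> bounded (range f)}"

definition sup_norm :: "('s \<Rightarrow> complex) \<Rightarrow> real" where
  "sup_norm f = (SUP s. cmod (f s))"

definition left_transl :: "('s \<Rightarrow> 's \<Rightarrow> 's) \<Rightarrow> 's \<Rightarrow> ('s \<Rightarrow> complex) \<Rightarrow> 's \<Rightarrow> complex" where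
  "left_transl m s f = (\<lambda>t. f (m s t))"

text \<open>
  Functionals on \<open>A\<close> are represented by extensional functions (\<open>undefined\<close> off \<open>A\<close>), so that each
  functional is represented exactly once. Continuity is automatic for multiplicative functionals.
\<close>

definition spectrum :: "('s \<Rightarrow> complex) set \<Rightarrow> (('s \<Rightarrow> complex) \<Rightarrow> complex) set" where
  "spectrum A = {\<mu> \<in> extensional A.
     (\<forall>f\<in>A. \<forall>g\<in>A. \<mu> (\<lambda>s. f s + g s) = \<mu> f + \<mu> g) \<and>
     (\<forall>c. \<forall>f\<in>A. \<mu> (\<lambda>s. c * f s) = c * \<mu> f) \<and>
     (\<forall>f\<in>A. \<forall>g\<in>A. \<mu> (\<lambda>s. f s * g s) = \<mu> f * \<mu> g) \<and>
     (\<exists>f\<in>A. \<mu> f \<noteq> 0)}"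

definition LMC :: "'s topology \<Rightarrow> ('s \<Rightarrow> 's \<Rightarrow> 's) \<Rightarrow> ('s \<Rightarrow> complex) set" where
  "LMC X m = {f \<in> bounded_cont X.
     \<forall>\<mu> \<in> spectrum (bounded_cont X). continuous_map X euclidean (\<lambda>s. \<mu> (left_transl m s f))}"

definition LMC_op ::
  "'s topology \<Rightarrow> ('s \<Rightarrow> 's \<Rightarrow> 's) \<Rightarrow> (('s \<Rightarrow> complex) \<Rightarrow> complex) \<Rightarrow> ('s \<Rightarrow> complex) \<Rightarrow> 's \<Rightarrow> complex"
  where "LMC_op X m \<mu> = (\<lambda>f \<in> LMC X m. \<lambda>s. \<mu> (left_transl m s f))"

definition Sigma_LMC ::
  "'s topology \<Rightarrow> ('s \<Rightarrow> 's \<Rightarrow> 's) \<Rightarrow> (('s \<Rightarrow> complex) \<Rightarrow> 's \<Rightarrow> complex) set" where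
  "Sigma_LMC X m = LMC_op X m ` spectrum (LMC X m)"

definition distal_functions :: "'s topology \<Rightarrow> ('s \<Rightarrow> 's \<Rightarrow> 's) \<Rightarrow> ('s \<Rightarrow> complex) set" where
  "distal_functions X m = {f \<in> LMC X m.
     \<forall>\<sigma> \<in> Sigma_LMC X m. \<forall>\<epsilon> \<in> Sigma_LMC X m. compose (LMC X m) \<epsilon> \<epsilon> = \<epsilon> \<longrightarrow> \<epsilon> (\<sigma> f) = \<sigma> f}"

primrec F_level :: "'s topology \<Rightarrow> ('s \<Rightarrow> 's \<Rightarrow> 's) \<Rightarrow> nat \<Rightarrow> ('s \<Rightarrow> complex) set" where
  "F_level X m 0 = {(\<lambda>s. c) | c. cmod c = 1}"
| "F_level X m (Suc k) = {f \<in> LMC X m. (\<forall>s. cmod (f s) = 1) \<and>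
     (\<forall>\<sigma> \<in> Sigma_LMC X m. \<exists>g \<in> F_level X m k. \<sigma> f = (\<lambda>s. g s * f s))}"

definition complex_function_algebra :: "('s \<Rightarrow> complex) set \<Rightarrow> bool" where
  "complex_function_algebra A \<longleftrightarrow>
     (\<lambda>s. 0) \<in> A \<and>
     (\<forall>f\<in>A. \<forall>g\<in>A. (\<lambda>s. f s + g s) \<in> A) \<and>
     (\<forall>c. \<forall>f\<in>A. (\<lambda>s. c * f s) \<in> A) \<and>
     (\<forall>f\<in>A. \<forall>g\<in>A. (\<lambda>s. f s * g s) \<in> A)"

definition W_algebra :: "'s topology \<Rightarrow> ('s \<Rightarrow> 's \<Rightarrow> 's) \<Rightarrow> ('s \<Rightarrow> complex) set" where
  "W_algebra X m = {f \<in> bounded_cont X. \<forall>e>0.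
     \<exists>g \<in> complex_function_algebra hull (\<Union>k\<in>{1..}. F_level X m k). sup_norm (\<lambda>s. f s - g s) < e}"

definition additive_character :: "('a :: ab_group_add \<Rightarrow> complex) \<Rightarrow> bool" where
  "additive_character \<psi> \<longleftrightarrow> (\<forall>x. cmod (\<psi> x) = 1) \<and> (\<forall>x y. \<psi> (x + y) = \<psi> x * \<psi> y)"

text \<open>
  Rings need be neither commutative nor unital (class \<open>ring\<close>). Without a unit there is no
  power \<open>t ^ 0\<close>, so the monomial \<open>a\<^sub>i t\<^sup>i\<close> is obtained from \<open>a\<^sub>i\<close> by multiplying \<open>i\<close> times by \<open>t\<close>
  on the right.
\<close>

definition ring_polynomial :: "('a :: ring \<Rightarrow> 'a) \<Rightarrow> bool" where
  "ring_polynomial q \<longleftrightarrow> (\<exists>d a. q = (\<lambda>t. \<Sum>i\<le>d. ((\<lambda>x. x * t) ^^ i) (a i)))"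

lemma ring_polynomial_ring_1:
  fixes q :: "'a :: ring_1 \<Rightarrow> 'a"
  shows "ring_polynomial q \<longleftrightarrow> (\<exists>d a. q = (\<lambda>t. \<Sum>i\<le>d. a i * t ^ i))"
proof -
  have "((\<lambda>x. x * t) ^^ i) b = b * t ^ i" for i and b t :: 'a
    by (induction i) (simp_all add: mult.assoc power_commutes)
  then show ?thesis
    by (simp add: ring_polynomial_def)
qed

end

theory Submission
  imports Defs
begin

text \<open>
  Call a unimodular function on an abelian group a phase polynomial of degree at most \<open>k\<close> if
  \<open>k\<close> successive multiplicative differences \<open>f (t + h) / f t\<close> reduce it to a constant. If
  \<open>f\<close> is one of degree \<open>k + 1\<close>, then \<open>T\<^sub>\<mu> f = g f\<close> with
  \<open>g s = \<mu> (\<lambda>t. f (s + t) / f s)\<close>; each \<open>\<lambda>s. f (s + t) / f s\<close> has degree \<open>k\<close>, and since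
  \<open>\<mu>\<close> is multiplicative it preserves this degree when applied in the parameter \<open>t\<close>. Hence
  \<open>f \<in> F\<^sub>k\<^sub>+\<^sub>1\<close>, which covers \<open>\<psi> \<circ> q\<close>. An idempotent \<open>\<epsilon>\<close> fixes every
  \<open>F\<^sub>k\<close> pointwise, by induction: if \<open>\<epsilon> f = g f\<close> and \<open>\<epsilon> g = g\<close>, then
  \<open>g f = \<epsilon> (\<epsilon> f) = g g f\<close>, so \<open>g = 1\<close>.
\<close>

section \<open>Multiplicative functionals on bounded functions\<close>

lemma LMC_discrete: "LMC (discrete_topology UNIV) m = {f. bounded (range f)}"
  by (simp add: LMC_def bounded_cont_def)

lemma bounded_range_unimodular: "(\<And>s. cmod (f s) = 1) \<Longrightarrow> bounded (range f)"
  by (auto simp: bounded_iff)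

lemma spectrum_bounded_add:
  assumes "\<mu> \<in> spectrum {f. bounded (range f)}" "bounded (range f)" "bounded (range g)"
  shows "\<mu> (\<lambda>s. f s + g s) = \<mu> f + \<mu> g"
  using assms by (simp add: spectrum_def)

lemma spectrum_bounded_mult:
  assumes "\<mu> \<in> spectrum {f. bounded (range f)}" "bounded (range f)" "bounded (range g)"
  shows "\<mu> (\<lambda>s. f s * g s) = \<mu> f * \<mu> g"
  using assms by (simp add: spectrum_def)

lemma spectrum_bounded_const:
  assumes "\<mu> \<in> spectrum {f. bounded (range f)}"
  shows "\<mu> (\<lambda>s. c) = c"
proof -
  obtain f where f: "bounded (range f)" "\<mu> f \<noteq> 0"
    using assms by (auto simp: spectrum_def)
  have "\<mu> (\<lambda>s. c * f s) = c * \<mu> f"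
    using assms f by (simp add: spectrum_def)
  moreover have "\<mu> (\<lambda>s. c * f s) = \<mu> (\<lambda>s. c) * \<mu> f"
    using f by (intro spectrum_bounded_mult[OF assms]) (auto intro: bounded_subset[of "{c}"])
  ultimately show ?thesis
    using f by simp
qed

text \<open>If \<open>\<mu> f\<close> kept a positive distance from the range,
  \<open>f - \<mu> f\<close> would have a bounded inverse. But \<open>\<mu>\<close> sends this
  difference to 0 and the constant 1 to 1.\<close>

lemma spectrum_bounded_in_closure:
  assumes \<mu>: "\<mu> \<in> spectrum {f. bounded (range f)}" and f: "bounded (range f)"
  shows "\<mu> f \<in> closure (range f)"
proof (rule ccontr)
  assume "\<mu> f \<notin> closure (range f)"
  then obtain e where e: "e > 0" "\<And>s. e \<le> cmod (f s - \<mu> f)"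
    unfolding closure_approachable dist_norm by (metis not_le rangeI)
  define g where "g s = f s + - \<mu> f" for s
  have bg: "bounded (range g)"
    using bounded_translation[OF f, of "- \<mu> f"] by (simp add: g_def image_image add.commute)
  have g: "e \<le> cmod (g s)" for s
    using e(2) by (simp add: g_def)
  have "cmod (1 / g s) \<le> 1 / e" for s
    using e(1) g[of s] by (simp add: norm_divide frac_le)
  then have bi: "bounded (range (\<lambda>s. 1 / g s))"
    by (intro boundedI) auto
  have "\<mu> g = \<mu> f + \<mu> (\<lambda>s. - \<mu> f)"
    unfolding g_def[abs_def]
    using f by (intro spectrum_bounded_add[OF \<mu>]) (auto intro: bounded_subset[of "{- \<mu> f}"])
  then have "\<mu> g = 0"
    using spectrum_bounded_const[OF \<mu>] by simp
  have "g s \<noteq> 0" for s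
    using e(1) g[of s] by auto
  then have "\<mu> (\<lambda>s. g s * (1 / g s)) = 1"
    using spectrum_bounded_const[OF \<mu>, of 1] by simp
  then show False
    using spectrum_bounded_mult[OF \<mu> bg bi] \<open>\<mu> g = 0\<close> by simp
qed

lemma spectrum_bounded_unimodular:
  assumes "\<mu> \<in> spectrum {f. bounded (range f)}" "\<And>s. cmod (f s) = 1"
  shows "cmod (\<mu> f) = 1"
proof -
  have "\<mu> f \<in> closure (range f)"
    using assms by (intro spectrum_bounded_in_closure bounded_range_unimodular)
  also have "closure (range f) \<subseteq> sphere 0 1"
    using assms(2) by (intro closure_minimal) auto
  finally show ?thesis
    by simp
qed

lemma spectrum_bounded_divide:
  assumes \<mu>: "\<mu> \<in> spectrum {f. bounded (range f)}"
    and f: "\<And>s. cmod (f s) = 1" and g: "\<And>s. cmod (g s) = 1"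
  shows "\<mu> (\<lambda>s. f s / g s) = \<mu> f / \<mu> g"
proof -
  have "\<mu> (\<lambda>s. f s / g s * g s) = \<mu> (\<lambda>s. f s / g s) * \<mu> g"
    by (intro spectrum_bounded_mult[OF \<mu>] bounded_range_unimodular)
       (simp_all add: f g norm_divide)
  moreover have "g s \<noteq> 0" for s
    using g[of s] by auto
  moreover have "\<mu> g \<noteq> 0"
    using spectrum_bounded_unimodular[of \<mu> g] \<mu> g by auto
  ultimately show ?thesis
    by (simp add: field_simps)
qed

section \<open>Phase polynomials and the levels \<open>F_level\<close>\<close>

fun phase_poly :: "nat \<Rightarrow> ('a :: ab_group_add \<Rightarrow> complex) \<Rightarrow> bool" where
  "phase_poly 0 f \<longleftrightarrow> (\<exists>c. cmod c = 1 \<and> f = (\<lambda>s. c))"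
| "phase_poly (Suc k) f \<longleftrightarrow>
     (\<forall>s. cmod (f s) = 1) \<and> (\<forall>h. phase_poly k (\<lambda>t. f (t + h) / f t))"

lemma phase_poly_unimodular: "phase_poly k f \<Longrightarrow> cmod (f s) = 1"
  by (cases k) auto

text \<open>As \<open>\<mu>\<close> respects quotients of unimodular functions, the difference by
  \<open>h\<close> of the new function is \<open>\<mu>\<close> applied to the differences by
  \<open>h\<close> of the \<open>u t\<close>. The induction therefore runs over whole families
  \<open>u\<close>.\<close>

lemma phase_poly_spectrum:
  assumes \<mu>: "\<mu> \<in> spectrum {f. bounded (range f)}"
  shows "(\<And>t. phase_poly k (u t)) \<Longrightarrow> phase_poly k (\<lambda>s. \<mu> (\<lambda>t. u t s))"
proof (induction k arbitrary: u)
  case 0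
  then obtain c where "\<And>t. cmod (c t) = 1" "\<And>t. u t = (\<lambda>s. c t)"
    by (simp, metis)
  then show ?case
    using spectrum_bounded_unimodular[OF \<mu>] by auto
next
  case (Suc k)
  note uni = phase_poly_unimodular[OF Suc.prems]
  have "phase_poly k (\<lambda>s. \<mu> (\<lambda>t. u t (s + h) / u t s))" for h
    using Suc.prems by (intro Suc.IH) simp
  then show ?case
    using spectrum_bounded_unimodular[OF \<mu> uni] spectrum_bounded_divide[OF \<mu> uni uni] by simp
qed

lemma phase_poly_in_F_level:
  "phase_poly k f \<Longrightarrow> f \<in> F_level (discrete_topology UNIV) (+) k"
proof (induction k arbitrary: f)
  case 0
  then show ?case by auto
next
  case (Suc k)
  note uni = phase_poly_unimodular[OF Suc.prems]
  have bd: "bounded (range f)"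
    by (rule bounded_range_unimodular) (rule uni)
  have "\<exists>g \<in> F_level (discrete_topology UNIV) (+) k. \<sigma> f = (\<lambda>s. g s * f s)"
    if "\<sigma> \<in> Sigma_LMC (discrete_topology UNIV) (+)" for \<sigma>
  proof -
    obtain \<mu> where \<mu>: "\<mu> \<in> spectrum {f :: 'a \<Rightarrow> complex. bounded (range f)}"
      and \<sigma>: "\<sigma> = LMC_op (discrete_topology UNIV) (+) \<mu>"
      using \<open>\<sigma> \<in> _\<close> by (auto simp: Sigma_LMC_def LMC_discrete)
    define g where "g s = \<mu> (\<lambda>t. f (s + t) / f s)" for s
    \<comment> \<open>For fixed \<open>s\<close> the denominator is constant in \<open>t\<close>,
      and \<open>\<mu>\<close> fixes constants.\<close>
    have "g s = \<mu> (\<lambda>t. f (s + t)) / f s" for s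
      unfolding g_def using spectrum_bounded_divide[OF \<mu>, of "\<lambda>t. f (s + t)" "\<lambda>t. f s"] uni
      by (simp add: spectrum_bounded_const[OF \<mu>])
    moreover have "f s \<noteq> 0" for s
      using uni[of s] by auto
    ultimately have "\<sigma> f = (\<lambda>s. g s * f s)"
      using bd by (simp add: \<sigma> LMC_op_def LMC_discrete left_transl_def)
    \<comment> \<open>For fixed \<open>t\<close>, the map from \<open>s\<close> to
      \<open>f (s + t) / f s\<close> is the difference of \<open>f\<close> by
      \<open>t\<close>.\<close>
    moreover have "phase_poly k g"
      unfolding g_def[abs_def] using Suc.prems by (intro phase_poly_spectrum[OF \<mu>]) simp
    ultimately show ?thesis
      using Suc.IH by blast
  qed
  then show ?case
    using uni bd by (simp add: LMC_discrete)
qed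

section \<open>From \<open>F_level\<close> to distal functions and \<open>W_algebra\<close>\<close>

lemma F_level_unimodular: "f \<in> F_level X m k \<Longrightarrow> cmod (f s) = 1"
  by (cases k) auto

lemma Sigma_discrete_const:
  assumes "\<sigma> \<in> Sigma_LMC (discrete_topology UNIV) m"
  shows "\<sigma> (\<lambda>s. c) = (\<lambda>s. c)"
  using assms
  by (auto simp: Sigma_LMC_def LMC_op_def LMC_discrete left_transl_def spectrum_bounded_const
      intro!: bounded_subset[of "{c}"])

lemma Sigma_discrete_mult:
  assumes "\<sigma> \<in> Sigma_LMC (discrete_topology UNIV) m"
    and f: "\<And>s. cmod (f s) = 1" and g: "\<And>s. cmod (g s) = 1"
  shows "\<sigma> (\<lambda>s. f s * g s) = (\<lambda>s. \<sigma> f s * \<sigma> g s)"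
proof -
  have "bounded (range f)" "bounded (range g)" "bounded (range (\<lambda>s. f s * g s))"
    by (rule bounded_range_unimodular, simp add: f g norm_mult)+
  moreover have "bounded (range (\<lambda>t. f (m s t)))" "bounded (range (\<lambda>t. g (m s t)))" for s
    by (rule bounded_range_unimodular, simp add: f g)+
  moreover obtain \<mu> where "\<mu> \<in> spectrum {f :: 'a \<Rightarrow> complex. bounded (range f)}"
      and "\<sigma> = LMC_op (discrete_topology UNIV) m \<mu>"
    using assms(1) by (auto simp: Sigma_LMC_def LMC_discrete)
  ultimately show ?thesis
    by (simp add: LMC_op_def LMC_discrete left_transl_def spectrum_bounded_mult[where \<mu> = \<mu>])
qed

lemma idempotent_fixes_F_level:
  assumes \<epsilon>: "\<epsilon> \<in> Sigma_LMC (discrete_topology UNIV) m"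
    and idem: "compose (LMC (discrete_topology UNIV) m) \<epsilon> \<epsilon> = \<epsilon>"
  shows "f \<in> F_level (discrete_topology UNIV) m k \<Longrightarrow> \<epsilon> f = f"
proof (induction k arbitrary: f)
  case 0
  then show ?case
    using Sigma_discrete_const[OF \<epsilon>] by auto
next
  case (Suc k)
  then obtain g where g: "g \<in> F_level (discrete_topology UNIV) m k" "\<epsilon> f = (\<lambda>s. g s * f s)"
    and "f \<in> LMC (discrete_topology UNIV) m"
    using \<epsilon> by auto
  \<comment> \<open>The restricted composition \<open>compose\<close> agrees with the true one at
    \<open>f\<close> because \<open>f\<close> lies in \<open>LMC\<close>.\<close>
  then have "\<epsilon> (\<epsilon> f) = \<epsilon> f"
    using idem by (metis compose_eq)
  moreover have "\<epsilon> (\<lambda>s. g s * f s) = (\<lambda>s. \<epsilon> g s * \<epsilon> f s)"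
    using F_level_unimodular[OF g(1)] F_level_unimodular[OF Suc.prems]
    by (rule Sigma_discrete_mult[OF \<epsilon>])
  ultimately have eq: "g s * (g s * f s) = g s * f s" for s
    using Suc.IH[OF g(1)] g(2) by metis
  have "g s \<noteq> 0" "f s \<noteq> 0" for s
    using F_level_unimodular[OF g(1), of s] F_level_unimodular[OF Suc.prems, of s] by auto
  with eq have "g s = 1" for s
    by simp
  then show ?case
    using g(2) by simp
qed

text \<open>Write \<open>\<sigma> f = g f\<close> with \<open>g\<close> one level lower. An
  idempotent is multiplicative on unimodular functions and fixes both \<open>g\<close> and
  \<open>f\<close>, hence their product.\<close>

lemma F_level_distal:
  assumes f: "f \<in> F_level (discrete_topology UNIV) m (Suc k)"
  shows "f \<in> distal_functions (discrete_topology UNIV) m"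
proof -
  have "\<epsilon> (\<sigma> f) = \<sigma> f"
    if \<sigma>: "\<sigma> \<in> Sigma_LMC (discrete_topology UNIV) m"
      and \<epsilon>: "\<epsilon> \<in> Sigma_LMC (discrete_topology UNIV) m"
      and idem: "compose (LMC (discrete_topology UNIV) m) \<epsilon> \<epsilon> = \<epsilon>" for \<sigma> \<epsilon>
  proof -
    obtain g where g: "g \<in> F_level (discrete_topology UNIV) m k" "\<sigma> f = (\<lambda>s. g s * f s)"
      using f \<sigma> by auto
    have "\<epsilon> (\<lambda>s. g s * f s) = (\<lambda>s. \<epsilon> g s * \<epsilon> f s)"
      using F_level_unimodular[OF g(1)] F_level_unimodular[OF f]
      by (rule Sigma_discrete_mult[OF \<epsilon>])
    then show ?thesis
      using idempotent_fixes_F_level[OF \<epsilon> idem g(1)] idempotent_fixes_F_level[OF \<epsilon> idem f] g(2)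
      by simp
  qed
  then show ?thesis
    using f by (simp add: distal_functions_def)
qed

text \<open>Such an \<open>f\<close> is itself a generator, so it serves as its own approximation
  for every \<open>e\<close>.\<close>

lemma F_level_in_W_algebra:
  assumes "k \<ge> 1" "f \<in> F_level X m k"
  shows "f \<in> W_algebra X m"
proof -
  have "f \<in> complex_function_algebra hull (\<Union>k\<in>{1..}. F_level X m k)"
    using assms by (intro hull_inc) auto
  moreover have "sup_norm (\<lambda>s. f s - f s) = 0"
    by (simp add: sup_norm_def)
  moreover have "f \<in> bounded_cont X"
    using assms by (cases k) (auto simp: LMC_def)
  ultimately show ?thesis
    unfolding W_algebra_def by force
qed

section \<open>Additive differences of polynomials\<close>

text \<open>
  The differences of a \<open>ring_polynomial\<close> over a noncommutative ring need not be
  \<open>ring_polynomial\<close>s, because the increment ends up between the factors \<open>t\<close>.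
\<close>

fun diff_poly :: "nat \<Rightarrow> ('a :: ab_group_add \<Rightarrow> 'b :: ab_group_add) \<Rightarrow> bool" where
  "diff_poly 0 q \<longleftrightarrow> (\<exists>c. q = (\<lambda>t. c))"
| "diff_poly (Suc k) q \<longleftrightarrow> (\<forall>h. diff_poly k (\<lambda>t. q (t + h) - q t))"

lemma diff_poly_const: "diff_poly k (\<lambda>t. c)"
  by (induction k arbitrary: c) auto

lemma diff_poly_Suc: "diff_poly k q \<Longrightarrow> diff_poly (Suc k) q"
proof (induction k arbitrary: q)
  case 0
  then show ?case by auto
next
  case (Suc k)
  have "diff_poly (Suc k) (\<lambda>t. q (t + h) - q t)" for h
    using Suc.prems by (intro Suc.IH) simp
  then show ?case
    by (subst diff_poly.simps(2)) blast
qed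

lemma diff_poly_mono: "k \<le> l \<Longrightarrow> diff_poly k q \<Longrightarrow> diff_poly l q"
  by (induction l rule: dec_induct) (use diff_poly_Suc in blast)+

lemma diff_poly_add: "diff_poly k p \<Longrightarrow> diff_poly k q \<Longrightarrow> diff_poly k (\<lambda>t. p t + q t)"
proof (induction k arbitrary: p q)
  case 0
  then show ?case by auto
next
  case (Suc k)
  have "diff_poly k (\<lambda>t. (p (t + h) - p t) + (q (t + h) - q t))" for h
    using Suc.prems by (intro Suc.IH) simp_all
  then show ?case
    by (simp add: algebra_simps)
qed

lemma diff_poly_sum: "(\<And>i. i \<in> I \<Longrightarrow> diff_poly k (p i)) \<Longrightarrow> diff_poly k (\<lambda>t. \<Sum>i\<in>I. p i t)"
  by (induction I rule: infinite_finite_induct) (simp_all add: diff_poly_const diff_poly_add)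

lemma diff_poly_translate: "diff_poly k q \<Longrightarrow> diff_poly k (\<lambda>t. q (t + h))"
proof (induction k arbitrary: q)
  case 0
  then show ?case by auto
next
  case (Suc k)
  have "diff_poly k (\<lambda>t. q ((t + h) + h') - q (t + h))" for h'
    using Suc.prems by (intro Suc.IH) simp
  then show ?case
    by (simp add: algebra_simps)
qed

lemma diff_poly_mult_const:
  fixes q :: "'a :: ab_group_add \<Rightarrow> 'b :: ring"
  shows "diff_poly k q \<Longrightarrow> diff_poly k (\<lambda>t. q t * c)"
proof (induction k arbitrary: q)
  case 0
  then show ?case by auto
next
  case (Suc k)
  have "diff_poly k (\<lambda>t. (q (t + h) - q t) * c)" for h
    using Suc.prems by (intro Suc.IH) simp
  then show ?case
    by (simp add: algebra_simps)
qed

text \<open>A Leibniz rule: the difference of \<open>q t * t\<close> by \<open>h\<close> is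
  \<open>(q (t + h) - q t) * t + q (t + h) * h\<close>. The induction hypothesis handles the first
  term; the second is a translate of \<open>q\<close> times a constant. No factors are
  interchanged.\<close>

lemma diff_poly_mult_id:
  fixes q :: "'a :: ring \<Rightarrow> 'a"
  shows "diff_poly k q \<Longrightarrow> diff_poly (Suc k) (\<lambda>t. q t * t)"
proof (induction k arbitrary: q)
  case 0
  then show ?case by (auto simp: algebra_simps)
next
  case (Suc k)
  have "diff_poly (Suc k) (\<lambda>t. (q (t + h) - q t) * t + q (t + h) * h)" for h
    using Suc.prems
    by (intro diff_poly_add Suc.IH diff_poly_mult_const diff_poly_translate) simp_all
  moreover have "(q (t + h) - q t) * t + q (t + h) * h = q (t + h) * (t + h) - q t * t" for h t
    by (simp add: algebra_simps)
  ultimately have "diff_poly (Suc k) (\<lambda>t. q (t + h) * (t + h) - q t * t)" for h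
    by (simp only:)
  then show ?case
    by (subst diff_poly.simps(2)) blast
qed

lemma ring_polynomial_diff_poly:
  assumes "ring_polynomial q"
  obtains d where "diff_poly d q"
proof -
  obtain d a where q: "q = (\<lambda>t. \<Sum>i\<le>d. ((\<lambda>x. x * t) ^^ i) (a i))"
    using assms by (auto simp: ring_polynomial_def)
  \<comment> \<open>Starting from the constant \<open>b\<close>, each right multiplication by
    \<open>t\<close> raises the degree bound by one.\<close>
  have "diff_poly i (\<lambda>t. ((\<lambda>x. x * t) ^^ i) b)" for i and b :: 'a
  proof (induction i)
    case 0
    then show ?case by auto
  next
    case (Suc i)
    then show ?case using diff_poly_mult_id[OF Suc] by (simp del: diff_poly.simps)
  qed
  then have "diff_poly d q"
    unfolding q by (intro diff_poly_sum) (auto intro: diff_poly_mono)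
  then show ?thesis ..
qed

section \<open>Composition with a character\<close>

lemma additive_character_diff:
  assumes "additive_character \<psi>"
  shows "\<psi> (x - y) = \<psi> x / \<psi> y"
proof -
  have "\<psi> (x - y) * \<psi> y = \<psi> x" "\<psi> y \<noteq> 0"
    using assms unfolding additive_character_def
    by (metis diff_add_cancel, metis norm_zero zero_neq_one)
  then show ?thesis
    by (simp add: field_simps)
qed

text \<open>A character turns the difference of \<open>q\<close> by \<open>h\<close> into the
  quotient that defines \<open>phase_poly\<close>, so the two recursions match level by
  level.\<close>

lemma phase_poly_character:
  assumes \<psi>: "additive_character \<psi>"
  shows "diff_poly k q \<Longrightarrow> phase_poly k (\<lambda>t. \<psi> (q t))"
proof (induction k arbitrary: q)
  case 0
  then show ?case
    using \<psi> by (auto simp: additive_character_def)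
next
  case (Suc k)
  have "phase_poly k (\<lambda>t. \<psi> (q (t + h) - q t))" for h
    using Suc.prems by (intro Suc.IH) simp
  then show ?case
    using \<psi> by (simp add: additive_character_diff[OF \<psi>]) (simp add: additive_character_def)
qed

theorem corollary4p3:
  fixes \<psi> :: "'a :: ring \<Rightarrow> complex" and q :: "'a \<Rightarrow> 'a"
  assumes "countable (UNIV :: 'a set)"
    and "additive_character \<psi>"
    and "ring_polynomial q"
  shows "(\<lambda>t. \<psi> (q t)) \<in> W_algebra (discrete_topology UNIV) (+) \<and>
         (\<lambda>t. \<psi> (q t)) \<in> distal_functions (discrete_topology UNIV) (+)"
proof -
  obtain d where "diff_poly d q"
    using assms(3) by (rule ring_polynomial_diff_poly)
  \<comment> \<open>The degree is raised because \<open>d\<close> may be 0, while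
    \<open>F_level_distal\<close> needs a successor level and the generators of
    \<open>W_algebra\<close> start at level 1.\<close>
  then have "diff_poly (Suc d) q"
    by (rule diff_poly_Suc)
  then have F: "(\<lambda>t. \<psi> (q t)) \<in> F_level (discrete_topology UNIV) (+) (Suc d)"
    by (intro phase_poly_in_F_level phase_poly_character[OF assms(2)])
  show ?thesis
    using F_level_distal[OF F] F_level_in_W_algebra[OF _ F] by simp
qed

end
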